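(* Let $(X,\rho)$ be a compact metric space of diameter $1$ and let $T\colon X\to X$ be a continuous surjective map such that $(X,T)$ has the partial specification property. Then the set $\mathcal{M}_T^e(X)$ of ergodic $T$-invariant Borel probability measures on $X$ is dense in the space $\mathcal{M}_T(X)$ of all $T$-invariant Borel probability measures on $X$ (with the weak$^*$ topology).
   Context: Here $\mathbb{N}=\{0,1,2,\dots\}$. Specifications. For $x\in X$ and $a<b$ in $\mathbb{N}$, $T^{[a,b)}(x)$ denotes the orbit segment $T^a(x),T^{a+1}(x),\dots,T^{b-1}(x)$. For $M\in\mathbb{N}$, a finite collection $\{T^{[a_i,b_i)}(x_i)\}_{i=1}^r$ ($r\ge 1$, $x_i\in X$, $a_i,b_i\in\mathbb{N}$) is an $M$-spaced specification if $a_1<b_1<a_2<b_2<\dots<a_r<b_r$ and $a_i-b_{i-1}\ge M$ for $i=2,\dots,r$. It is $\varepsilon$-partially traced by $z\in X$ if for every $1\le i\le r$ we have $|\Lambda_i|/(b_i-a_i)>1-\varepsilon$, where $\Lambda_i=\{a_i\le n<b_i : \rho(T^n(z),T^n(x_i))<\varepsilon\}$. Partial specification. Let $P\subset\mathbb{N}$. $(X,T)$ has the partial specification property with periods $P$ if for every $\varepsilon>0$ there exist $M,N\in\mathbb{N}$ such that for every $M$-spaced specification $\{T^{[a_i,b_i)}(x_i)\}_{i=1}^r$ and every $n\in P$ with $n\ge\max\{N,(1+\varepsilon)b_r\}$ there is a point $z\in X$ of period $n$ (i.e. $T^n(z)=z$) which $\varepsilon$-partially traces the specification. $(X,T)$ has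 the partial specification property if for every $c\in\mathbb{N}$ there is $P\subset c\mathbb{N}$ such that $(X,T)$ has the partial specification property with periods $P$.
   Formalization: In the partial specification property, the set of periods P ⊂ cℕ is required to be infinite and c ≥ 1; with P empty or finite the property holds for every map and the claim fails (identity on two points at distance 1). *)

theory Defs
  imports "HOL-Probability.Probability"
begin

text \<open>
  The orbit segments of a specification are given by families \<open>a\<close>, \<open>b\<close>, \<open>x\<close>
  indexed by \<open>{1..r}\<close>; values at other indices are irrelevant.
\<close>

definition spaced_specification :: "nat \<Rightarrow> nat \<Rightarrow> (nat \<Rightarrow> nat) \<Rightarrow> (nat \<Rightarrow> nat) \<Rightarrow> bool" where
  "spaced_specification M r a b \<longleftrightarrow>
     r \<ge> 1 \<and> (\<forall>i\<in>{1..r}. a i < b i) \<and>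
     (\<forall>i\<in>{2..r}. b (i - 1) < a i \<and> a i - b (i - 1) \<ge> M)"

definition partially_traces ::
  "('a::metric_space \<Rightarrow> 'a) \<Rightarrow> real \<Rightarrow> nat \<Rightarrow> (nat \<Rightarrow> nat) \<Rightarrow> (nat \<Rightarrow> nat) \<Rightarrow> (nat \<Rightarrow> 'a) \<Rightarrow> 'a \<Rightarrow> bool" where
  "partially_traces T \<epsilon> r a b x z \<longleftrightarrow>
     (\<forall>i\<in>{1..r}.
        real (card {n. a i \<le> n \<and> n < b i \<and> dist ((T ^^ n) z) ((T ^^ n) (x i)) < \<epsilon>})
          / real (b i - a i) > 1 - \<epsilon>)"

definition partial_specification_with_periods :: "('a::metric_space \<Rightarrow> 'a) \<Rightarrow> nat set \<Rightarrow> bool" where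
  "partial_specification_with_periods T P \<longleftrightarrow>
     (\<forall>\<epsilon>::real. \<epsilon> > 0 \<longrightarrow>
       (\<exists>M N :: nat. \<forall>r a b x. spaced_specification M r a b \<longrightarrow>
          (\<forall>n\<in>P. real n \<ge> max (real N) ((1 + \<epsilon>) * real (b r)) \<longrightarrow>
             (\<exists>z. (T ^^ n) z = z \<and> partially_traces T \<epsilon> r a b x z))))"

text \<open>
  The set of periods has to be infinite: for finite \<open>P\<close> the previous property holds for every
  map (choose \<open>N\<close> larger than all elements of \<open>P\<close>). Accordingly \<open>c\<close> is positive,
  since no infinite set is contained in \<open>0\<nat> = {0}\<close>.
\<close>

definition partial_specification_property :: "('a::metric_space \<Rightarrow> 'a) \<Rightarrow> bool" where
  "partial_specification_property T \<longleftrightarrow>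
     (\<forall>c::nat. c \<ge> 1 \<longrightarrow>
       (\<exists>P. infinite P \<and> P \<subseteq> {n. c dvd n} \<and> partial_specification_with_periods T P))"

definition borel_prob_measures :: "'a::topological_space measure set" where
  "borel_prob_measures = {\<mu>. sets \<mu> = sets borel \<and> prob_space \<mu>}"

definition invariant_measures :: "('a::topological_space \<Rightarrow> 'a) \<Rightarrow> 'a measure set" where
  "invariant_measures T =
     {\<mu> \<in> borel_prob_measures. \<forall>A\<in>sets borel. measure \<mu> (T -` A) = measure \<mu> A}"

definition ergodic_measures :: "('a::topological_space \<Rightarrow> 'a) \<Rightarrow> 'a measure set" where
  "ergodic_measures T =
     {\<mu> \<in> invariant_measures T.
        \<forall>A\<in>sets borel. T -` A = A \<longrightarrow> measure \<mu> A = 0 \<or> measure \<mu> A = 1}"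

text \<open>
  The weak* topology on Borel probability measures of a compact space: the coarsest topology
  making \<open>\<mu> \<mapsto> \<integral>f d\<mu>\<close> continuous for every continuous \<open>f\<close>. (On a non-compact space one would
  have to restrict to bounded \<open>f\<close>.)
\<close>

definition weak_star_topology :: "'a::topological_space measure topology" where
  "weak_star_topology =
     pullback_topology borel_prob_measures
       (\<lambda>\<mu>. \<lambda>f\<in>{f. continuous_on UNIV f}. integral\<^sup>L \<mu> f)
       (powertop_real {f :: 'a \<Rightarrow> real. continuous_on UNIV f})"

end

theory Submission
  imports Defs
begin

text \<open>
  Measures on periodic orbits are ergodic, and they are already dense. No ergodic decomposition
  is needed: for fixed \<open>m\<close>, every invariant \<open>\<mu>\<close> is approximated, uniformly in \<open>L\<close>, by the average
  of \<open>m\<close> orbit segments of length \<open>L\<close>, because an average of \<open>m\<close> suitable samples of the Birkhoff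
  average has error \<open>O(1 / sqrt m)\<close>, independently of \<open>L\<close>. Choosing \<open>m\<close> first, then the gap \<open>M\<close>,
  and then a large period \<open>n\<close> with \<open>L\<close> close to \<open>n / m\<close>, the gaps become negligible, and the
  periodic point that partially traces the \<open>m\<close> segments has averages close to \<open>\<mu>\<close>.
\<close>

section \<open>Empirical averages\<close>

text \<open>Turns a bound on a mean error into a bound at an actual point; this is how each new
  sample is found. If \<open>X\<close> exceeded its mean everywhere, its mean would exceed
  itself.\<close>

lemma (in prob_space) exists_le_expectation:
  fixes X :: "'a \<Rightarrow> real"
  assumes "integrable M X"
  shows "\<exists>x\<in>space M. X x \<le> expectation X"
proof (rule ccontr)
  assume "\<not> ?thesis"
  then have "AE x in M. expectation X < X x"
    by (intro AE_I2) auto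
  from expectation_greater[OF assms this] show False
    by simp
qed

text \<open>
  Derandomised law of large numbers: the cross term with a centred new sample has mean zero, so
  some choice of that sample increases the squared error by at most its variance.
\<close>

lemma (in prob_space) exists_empirical_average:
  fixes G :: "'i \<Rightarrow> 'a \<Rightarrow> real"
  assumes "finite I"
    and meas: "\<And>i. i \<in> I \<Longrightarrow> G i \<in> borel_measurable M"
    and bound: "\<And>i x. i \<in> I \<Longrightarrow> x \<in> space M \<Longrightarrow> \<bar>G i x\<bar> \<le> B"
  shows "\<exists>y. (\<forall>j<m. y j \<in> space M) \<and>
    (\<Sum>i\<in>I. (\<Sum>j<m. G i (y j) - expectation (G i))\<^sup>2) \<le> real m * (real (card I) * B\<^sup>2)"
proof (induction m)
  case 0
  show ?case by simp
next
  case (Suc m)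
  then obtain y where y: "\<And>j. j < m \<Longrightarrow> y j \<in> space M"
    and le: "(\<Sum>i\<in>I. (\<Sum>j<m. G i (y j) - expectation (G i))\<^sup>2) \<le> real m * (real (card I) * B\<^sup>2)"
    by blast
  \<comment> \<open>Accumulated error of the \<open>m\<close> samples chosen so far, one coordinate
    for each \<open>i\<close>; the induction controls its squared Euclidean norm.\<close>
  define v where "v i = (\<Sum>j<m. G i (y j) - expectation (G i))" for i
  have int1: "integrable M (G i)" if "i \<in> I" for i
    using that by (intro integrable_const_bound[where B = B] meas AE_I2) (auto simp: bound)
  have sq: "(G i x)\<^sup>2 \<le> B\<^sup>2" if "i \<in> I" "x \<in> space M" for i x
    using power_mono[OF bound[OF that], of 2] by simp
  have int2: "integrable M (\<lambda>x. (G i x)\<^sup>2)" if "i \<in> I" for i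
    using that by (intro integrable_const_bound[where B = "B\<^sup>2"] AE_I2 borel_measurable_power meas)
      (auto simp: sq)
  have int2': "integrable M (\<lambda>x. (G i x - c)\<^sup>2)" if "i \<in> I" for i c
    unfolding power2_diff using that by (intro Bochner_Integration.integrable_diff
      Bochner_Integration.integrable_add integrable_mult_left integrable_mult_right int1 int2) auto
  have int3: "integrable M (\<lambda>x. (v i + (G i x - expectation (G i)))\<^sup>2)" if "i \<in> I" for i
    unfolding power2_sum using that int2'[OF that] int1[OF that]
    by (intro Bochner_Integration.integrable_add integrable_mult_left integrable_mult_right) auto
  have E: "expectation (\<lambda>x. (v i + (G i x - expectation (G i)))\<^sup>2) \<le> (v i)\<^sup>2 + B\<^sup>2" if "i \<in> I" for i
  proof -
    have "expectation (\<lambda>x. (v i + (G i x - expectation (G i)))\<^sup>2) = (v i)\<^sup>2 + variance (G i)"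
      unfolding power2_sum using int2'[OF that] int1[OF that]
      by (simp add: prob_space)
    also have "variance (G i) \<le> expectation (\<lambda>x. (G i x)\<^sup>2)"
      using variance_eq[OF int1[OF that] int2[OF that]] by simp
    also have "\<dots> \<le> B\<^sup>2"
      using that int2[OF that] by (intro integral_le_const AE_I2 sq)
    finally show ?thesis by simp
  qed
  \<comment> \<open>One new point has to serve all indices at once, so it is selected for the sum
    over \<open>I\<close> and not for each \<open>i\<close> separately.\<close>
  have "integrable M (\<lambda>x. \<Sum>i\<in>I. (v i + (G i x - expectation (G i)))\<^sup>2)"
    by (intro Bochner_Integration.integrable_sum int3)
  from exists_le_expectation[OF this] obtain x where x: "x \<in> space M"
    and le': "(\<Sum>i\<in>I. (v i + (G i x - expectation (G i)))\<^sup>2)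
      \<le> expectation (\<lambda>x. \<Sum>i\<in>I. (v i + (G i x - expectation (G i)))\<^sup>2)"
    by blast
  note le'
  also have "expectation (\<lambda>x. \<Sum>i\<in>I. (v i + (G i x - expectation (G i)))\<^sup>2)
      = (\<Sum>i\<in>I. expectation (\<lambda>x. (v i + (G i x - expectation (G i)))\<^sup>2))"
    by (intro Bochner_Integration.integral_sum int3)
  also have "\<dots> \<le> (\<Sum>i\<in>I. (v i)\<^sup>2 + B\<^sup>2)"
    by (intro sum_mono E)
  also have "\<dots> \<le> real (Suc m) * (real (card I) * B\<^sup>2)"
    using le by (simp add: sum.distrib v_def algebra_simps)
  finally have "(\<Sum>i\<in>I. (\<Sum>j<Suc m. G i ((y(m := x)) j) - expectation (G i))\<^sup>2)
      \<le> real (Suc m) * (real (card I) * B\<^sup>2)"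
    by (simp add: v_def)
  moreover have "\<forall>j<Suc m. (y(m := x)) j \<in> space M"
    using x y by (auto simp: less_Suc_eq)
  ultimately show ?case by blast
qed

section \<open>Continuous functions on compact spaces\<close>

lemma finite_continuous_bounded:
  fixes F :: "('a::metric_space \<Rightarrow> real) set"
  assumes "compact (UNIV :: 'a set)" "finite F" "\<And>f. f \<in> F \<Longrightarrow> continuous_on UNIV f"
  shows "\<exists>C>0. \<forall>f\<in>F. \<forall>x. \<bar>f x\<bar> \<le> C"
  using assms(2,3)
proof (induction F rule: finite_induct)
  case empty
  show ?case by (auto intro: exI[of _ 1])
next
  case (insert f F)
  then obtain C where C: "C > 0" "\<forall>f\<in>F. \<forall>x. \<bar>f x\<bar> \<le> C" by auto
  have "bounded (range f)"
    using insert.prems assms(1) by (intro compact_imp_bounded compact_continuous_image) auto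
  then obtain B where B: "\<And>x. \<bar>f x\<bar> \<le> B"
    by (auto simp: bounded_iff)
  show ?case
    using C B by (intro exI[of _ "max C B"]) (auto simp: less_max_iff_disj le_max_iff_disj)
qed

lemma finite_uniformly_continuous:
  fixes F :: "('a::metric_space \<Rightarrow> real) set"
  assumes "compact (UNIV :: 'a set)" "finite F" "\<And>f. f \<in> F \<Longrightarrow> continuous_on UNIV f" "\<eta> > 0"
  shows "\<exists>d>0. \<forall>f\<in>F. \<forall>x y. dist x y < d \<longrightarrow> \<bar>f x - f y\<bar> < \<eta>"
  using assms(2,3)
proof (induction F rule: finite_induct)
  case empty
  show ?case by (auto intro: exI[of _ 1])
next
  case (insert f F)
  then obtain d where d: "d > 0" "\<forall>f\<in>F. \<forall>x y. dist x y < d \<longrightarrow> \<bar>f x - f y\<bar> < \<eta>" by auto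
  have "uniformly_continuous_on UNIV f"
    using insert.prems assms(1) by (intro compact_uniformly_continuous) auto
  then obtain e where e: "e > 0" "\<And>x y. dist x y < e \<Longrightarrow> \<bar>f x - f y\<bar> < \<eta>"
    using assms(4) unfolding uniformly_continuous_on_def dist_real_def by blast
  show ?case
    using d e by (intro exI[of _ "min d e"]) auto
qed

section \<open>Periodic orbit measures\<close>

text \<open>The uniform distribution on the times \<open>0, ..., n - 1\<close> pushed forward along
  the orbit, so that points are counted with multiplicity and \<open>n\<close> may be any period,
  not only the least one. It is a probability measure for every \<open>n\<close>, because a
  \<open>pmf\<close> always is.\<close>

definition orbit_measure :: "('a::topological_space \<Rightarrow> 'a) \<Rightarrow> nat \<Rightarrow> 'a \<Rightarrow> 'a measure" where
  "orbit_measure T n z = distr (measure_pmf (pmf_of_set {..<n})) borel (\<lambda>j. (T ^^ j) z)"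

lemma integral_orbit_measure:
  fixes f :: "'a::topological_space \<Rightarrow> real"
  assumes "n > 0" "f \<in> borel_measurable borel"
  shows "integral\<^sup>L (orbit_measure T n z) f = (\<Sum>j<n. f ((T ^^ j) z)) / real n"
  unfolding orbit_measure_def using assms
  by (subst integral_distr) (auto simp: integral_pmf_of_set lessThan_empty_iff)

lemma orbit_measure_in_borel_prob_measures: "orbit_measure T n z \<in> borel_prob_measures"
  by (simp add: borel_prob_measures_def orbit_measure_def measure_pmf.prob_space_distr)

lemma measure_orbit_measure:
  assumes "n > 0" "A \<in> sets borel"
  shows "measure (orbit_measure T n z) A = (\<Sum>j<n. indicator A ((T ^^ j) z)) / real n"
proof -
  interpret prob_space "orbit_measure T n z"
    using orbit_measure_in_borel_prob_measures by (auto simp: borel_prob_measures_def)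
  have "measure (orbit_measure T n z) A = integral\<^sup>L (orbit_measure T n z) (indicator A)"
    using assms by (simp add: orbit_measure_def)
  also have "\<dots> = (\<Sum>j<n. indicator A ((T ^^ j) z)) / real n"
    using assms by (intro integral_orbit_measure borel_measurable_indicator)
  finally show ?thesis .
qed

lemma orbit_measure_ergodic:
  fixes T :: "'a::metric_space \<Rightarrow> 'a"
  assumes T: "continuous_on UNIV T" and "n > 0" and per: "(T ^^ n) z = z"
  shows "orbit_measure T n z \<in> ergodic_measures T"
proof -
  have [measurable]: "T \<in> borel_measurable borel"
    using T by (rule borel_measurable_continuous_onI)
  have "measure (orbit_measure T n z) (T -` A) = measure (orbit_measure T n z) A"
    if A: "A \<in> sets borel" for A
  proof -
    have "T -` A \<in> sets borel"
      using A measurable_sets[of T borel borel A] by simp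
    moreover have "(\<Sum>j<n. indicator (T -` A) ((T ^^ j) z)) = (\<Sum>j<n. indicator A ((T ^^ j) z) :: real)"
    proof -
      let ?g = "\<lambda>j. indicator A ((T ^^ j) z) :: real"
      have "(\<Sum>j<n. indicator (T -` A) ((T ^^ j) z)) = (\<Sum>j<n. ?g (Suc j))"
        by (simp add: indicator_def)
      \<comment> \<open>The shifted sum gains the term at time \<open>n\<close> and loses the one at
        time 0; these agree by periodicity.\<close>
      also have "\<dots> = (\<Sum>j<n. ?g j)"
        using sum.lessThan_Suc_shift[of ?g n] sum.lessThan_Suc[of ?g n] per by simp
      finally show ?thesis .
    qed
    ultimately show ?thesis
      using A \<open>n > 0\<close> by (simp add: measure_orbit_measure)
  qed
  moreover have "measure (orbit_measure T n z) A = 0 \<or> measure (orbit_measure T n z) A = 1"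
    if A: "A \<in> sets borel" and inv: "T -` A = A" for A
  proof -
    have "(T ^^ j) z \<in> A \<longleftrightarrow> z \<in> A" for j
      by (induction j) (use inv in auto)
    then have "indicator A ((T ^^ j) z) = (indicator A z :: real)" for j
      by (simp add: indicator_def)
    then show ?thesis
      using A \<open>n > 0\<close> by (simp add: measure_orbit_measure indicator_def)
  qed
  ultimately show ?thesis
    by (simp add: ergodic_measures_def invariant_measures_def orbit_measure_in_borel_prob_measures)
qed

text \<open>Invariance on sets says that the push-forward of \<open>\<mu>\<close> under
  \<open>T\<close> is \<open>\<mu>\<close>, so a change of variables settles a single step. The
  function stays arbitrary in the induction because the hypothesis is applied to \<open>f\<close>
  composed with \<open>T\<close>.\<close>

lemma integral_invariant:
  fixes T :: "'a::metric_space \<Rightarrow> 'a" and f :: "'a \<Rightarrow> real"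
  assumes \<mu>: "\<mu> \<in> invariant_measures T" and T: "continuous_on UNIV T" and f: "f \<in> borel_measurable borel"
  shows "integral\<^sup>L \<mu> (\<lambda>x. f ((T ^^ s) x)) = integral\<^sup>L \<mu> f"
  using f
proof (induction s arbitrary: f)
  case 0
  show ?case by simp
next
  case (Suc s)
  have sets [measurable_cong]: "sets \<mu> = sets borel" and "prob_space \<mu>"
    and inv: "\<And>A. A \<in> sets borel \<Longrightarrow> measure \<mu> (T -` A) = measure \<mu> A"
    using \<mu> by (auto simp: invariant_measures_def borel_prob_measures_def)
  interpret prob_space \<mu> by fact
  have [measurable]: "T \<in> borel_measurable borel" "f \<in> borel_measurable borel"
    using borel_measurable_continuous_onI[OF T] Suc.prems by auto
  have sp: "space \<mu> = UNIV"
    using sets_eq_imp_space_eq[OF sets] by simp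
  have "distr \<mu> borel T = \<mu>"
  proof (rule measure_eqI)
    fix A assume "A \<in> sets (distr \<mu> borel T)"
    then have A: "A \<in> sets borel" by simp
    then show "emeasure (distr \<mu> borel T) A = emeasure \<mu> A"
      using inv[OF A] by (simp add: emeasure_distr sp emeasure_eq_measure)
  qed (simp add: sets)
  then have "integral\<^sup>L \<mu> f = integral\<^sup>L (distr \<mu> borel T) f" by simp
  also have "\<dots> = integral\<^sup>L \<mu> (\<lambda>x. f (T x))"
    by (rule integral_distr) auto
  also have "\<dots> = integral\<^sup>L \<mu> (\<lambda>x. f (T ((T ^^ s) x)))"
    by (rule Suc.IH[symmetric, where f = "\<lambda>x. f (T x)"]) measurable
  finally show ?case by simp
qed

section \<open>Tracing an invariant measure by a periodic orbit\<close>

text \<open>At the traced times the two values differ by at most \<open>\<eta>\<close>. The other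
  times make up at most a fraction \<open>\<epsilon>\<close> of the segment, and there the trivial
  bound \<open>2 * C\<close> is used.\<close>

lemma partial_tracing_sum:
  fixes f :: "'a::metric_space \<Rightarrow> real" and u w :: "nat \<Rightarrow> 'a"
  assumes trace: "real (card {n. a \<le> n \<and> n < b \<and> dist (u n) (w n) < \<epsilon>}) / real (b - a) > 1 - \<epsilon>"
    and "a < b" and C: "\<And>x. \<bar>f x\<bar> \<le> C" and "\<eta> \<ge> 0"
    and close: "\<And>x y. dist x y < \<epsilon> \<Longrightarrow> \<bar>f x - f y\<bar> \<le> \<eta>"
  shows "\<bar>\<Sum>t=a..<b. f (u t) - f (w t)\<bar> \<le> real (b - a) * (2 * C * \<epsilon> + \<eta>)"
proof -
  define A where "A = {n. a \<le> n \<and> n < b \<and> dist (u n) (w n) < \<epsilon>}"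
  have A: "A \<subseteq> {a..<b}" by (auto simp: A_def)
  then have fin: "finite A" by (rule finite_subset) simp
  have C0: "C \<ge> 0" using C[of undefined] by linarith
  have "card A \<le> b - a" using card_mono[OF _ A] by simp
  then have card: "real (card ({a..<b} - A)) = real (b - a) - real (card A)"
    using A by (simp add: card_Diff_subset fin of_nat_diff)
  have "real (b - a) * (1 - \<epsilon>) \<le> real (card A)"
    using trace \<open>a < b\<close> by (simp add: A_def field_simps)
  then have bad: "real (card ({a..<b} - A)) \<le> real (b - a) * \<epsilon>"
    using card by (simp add: algebra_simps)
  have "\<bar>\<Sum>t=a..<b. f (u t) - f (w t)\<bar> \<le> (\<Sum>t=a..<b. \<bar>f (u t) - f (w t)\<bar>)"
    by (rule sum_abs)
  also have "\<dots> = (\<Sum>t\<in>{a..<b} - A. \<bar>f (u t) - f (w t)\<bar>) + (\<Sum>t\<in>A. \<bar>f (u t) - f (w t)\<bar>)"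
    by (rule sum.subset_diff[OF A]) simp
  also have "(\<Sum>t\<in>{a..<b} - A. \<bar>f (u t) - f (w t)\<bar>) \<le> real (card ({a..<b} - A)) * (2 * C)"
  proof (rule sum_bounded_above)
    fix t show "\<bar>f (u t) - f (w t)\<bar> \<le> 2 * C"
      using C[of "u t"] C[of "w t"] by linarith
  qed
  also have "(\<Sum>t\<in>A. \<bar>f (u t) - f (w t)\<bar>) \<le> real (card A) * \<eta>"
    by (rule sum_bounded_above) (auto simp: A_def intro: close)
  also have "real (card ({a..<b} - A)) * (2 * C) \<le> real (b - a) * \<epsilon> * (2 * C)"
    using bad C0 by (intro mult_right_mono) auto
  also have "real (card A) * \<eta> \<le> real (b - a) * \<eta>"
    using \<open>card A \<le> b - a\<close> \<open>\<eta> \<ge> 0\<close> by (intro mult_right_mono) auto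
  finally show ?thesis by (simp add: algebra_simps)
qed

text \<open>Only the first \<open>L\<close> times of each of the \<open>m\<close> blocks of length
  \<open>K\<close> are under control. The discarded times are the ends of the blocks and the tail
  after \<open>m * K\<close>; there are \<open>n - m * L\<close> of them, each costing at most
  \<open>D\<close>.\<close>

lemma sum_blocks_bound:
  fixes h :: "nat \<Rightarrow> real"
  assumes D: "\<And>t. \<bar>h t\<bar> \<le> D" and "L \<le> K" "m * K \<le> n"
  shows "\<bar>\<Sum>t<n. h t\<bar> \<le> \<bar>\<Sum>i<m. \<Sum>t=i*K..<i*K+L. h t\<bar> + D * (real n - real m * real L)"
proof -
  have sum_le: "\<bar>sum h S\<bar> \<le> real (card S) * D" for S
    by (rule order_trans[OF sum_abs sum_bounded_above]) (rule D)
  have "(\<Sum>t<n. h t) = (\<Sum>t<m*K. h t) + (\<Sum>t=m*K..<n. h t)"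
    using \<open>m * K \<le> n\<close> sum.atLeastLessThan_concat[of 0 "m * K" n h] by (simp add: atLeast0LessThan)
  moreover have "(\<Sum>t<m*K. h t) = (\<Sum>i<m. \<Sum>t=i*K..<i*K+K. h t)"
    by (rule sum.nat_group[symmetric])
  moreover have "(\<Sum>i<m. \<Sum>t=i*K..<i*K+K. h t)
      = (\<Sum>i<m. \<Sum>t=i*K..<i*K+L. h t) + (\<Sum>i<m. \<Sum>t=i*K+L..<i*K+K. h t)"
    unfolding sum.distrib[symmetric] using \<open>L \<le> K\<close>
    by (intro sum.cong refl sum.atLeastLessThan_concat[symmetric]) auto
  moreover have "\<bar>\<Sum>i<m. \<Sum>t=i*K+L..<i*K+K. h t\<bar> \<le> real m * (real (K - L) * D)"
  proof -
    have "\<bar>\<Sum>i<m. \<Sum>t=i*K+L..<i*K+K. h t\<bar> \<le> (\<Sum>i<m. \<bar>\<Sum>t=i*K+L..<i*K+K. h t\<bar>)"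
      by (rule sum_abs)
    also have "\<dots> \<le> (\<Sum>i<m. real (K - L) * D)"
      by (intro sum_mono order_trans[OF sum_le]) simp
    finally show ?thesis by simp
  qed
  moreover have "\<bar>\<Sum>t=m*K..<n. h t\<bar> \<le> (real n - real m * real K) * D"
    using sum_le[of "{m*K..<n}"] \<open>m * K \<le> n\<close> by (simp add: of_nat_diff)
  moreover have "real m * (real (K - L) * D) + (real n - real m * real K) * D
      = D * (real n - real m * real L)"
    using \<open>L \<le> K\<close> by (simp add: of_nat_diff algebra_simps)
  ultimately show ?thesis by linarith
qed

text \<open>The quantitative core. Three errors are added: sampling \<open>\<mu>\<close> by
  \<open>m\<close> segments, tracing these segments only partially, and the times of the period
  outside all segments. The number \<open>m\<close> depends only on \<open>F\<close> and
  \<open>\<delta>\<close>, and it is fixed before \<open>n\<close>; hence the total gap length, of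
  order \<open>m * M\<close>, is negligible against \<open>n\<close>.\<close>

lemma exists_periodic_averages:
  fixes T :: "'a::metric_space \<Rightarrow> 'a" and F :: "('a \<Rightarrow> real) set"
  assumes cpt: "compact (UNIV :: 'a set)" and T: "continuous_on UNIV T" and "surj T"
    and P: "partial_specification_with_periods T P" "infinite P"
    and \<mu>: "\<mu> \<in> invariant_measures T"
    and F: "finite F" "\<And>f. f \<in> F \<Longrightarrow> continuous_on UNIV f" and "\<delta> > 0"
  shows "\<exists>n>0. \<exists>z. (T ^^ n) z = z \<and>
    (\<forall>f\<in>F. \<bar>(\<Sum>t<n. f ((T ^^ t) z)) / real n - integral\<^sup>L \<mu> f\<bar> < \<delta>)"
proof -
  have sets [measurable_cong]: "sets \<mu> = sets borel" and "prob_space \<mu>"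
    using \<mu> by (auto simp: invariant_measures_def borel_prob_measures_def)
  interpret prob_space \<mu> by fact
  have meas [measurable]: "f \<in> borel_measurable borel" if "f \<in> F" for f
    using that F by (intro borel_measurable_continuous_onI) auto
  have [measurable]: "T ^^ s \<in> borel_measurable borel" for s
    using borel_measurable_continuous_onI[OF T] by (induction s) auto

  \<comment> \<open>Choice of the constants, from the accuracy to the period\<close>
  obtain C where "C > 0" and C: "\<And>f x. f \<in> F \<Longrightarrow> \<bar>f x\<bar> \<le> C"
    using finite_continuous_bounded[OF cpt F] by blast
  \<comment> \<open>The errors will add up to at most \<open>4 * \<eta>\<close>; the fifth share
    makes the final inequality strict.\<close>
  define \<eta> where "\<eta> = \<delta> / 5"
  have "\<eta> > 0" using \<open>\<delta> > 0\<close> by (simp add: \<eta>_def)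
  obtain d where "d > 0" and d: "\<And>f x y. f \<in> F \<Longrightarrow> dist x y < d \<Longrightarrow> \<bar>f x - f y\<bar> < \<eta>"
    using finite_uniformly_continuous[OF cpt F \<open>\<eta> > 0\<close>] by blast
  \<comment> \<open>The bound \<open>d\<close> makes traced times accurate up to
    \<open>\<eta>\<close>. The other bound pays for two losses of \<open>2 * C * \<epsilon>\<close>
    per unit of time: untraced times, and the part of the period reserved by the factor
    \<open>1 + \<epsilon>\<close>.\<close>
  define \<epsilon> where "\<epsilon> = min d (\<eta> / (4 * C))"
  have "\<epsilon> > 0" using \<open>d > 0\<close> \<open>\<eta> > 0\<close> \<open>C > 0\<close> by (simp add: \<epsilon>_def)
  have "\<epsilon> \<le> \<eta> / (4 * C)" by (simp add: \<epsilon>_def)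
  then have \<epsilon>C: "4 * C * \<epsilon> \<le> \<eta>" using \<open>C > 0\<close> by (simp add: field_simps)
  obtain M N where spec: "\<And>r a b x n. spaced_specification M r a b \<Longrightarrow> n \<in> P \<Longrightarrow>
      real n \<ge> max (real N) ((1 + \<epsilon>) * real (b r)) \<Longrightarrow>
      \<exists>z. (T ^^ n) z = z \<and> partially_traces T \<epsilon> r a b x z"
    using P(1) \<open>\<epsilon> > 0\<close> unfolding partial_specification_with_periods_def by metis
  \<comment> \<open>Chosen so that the bound on the total squared error of \<open>m\<close> samples
    of size at most \<open>L * C\<close> stays below the square of \<open>\<eta> * m * L\<close>.
    The length \<open>L\<close> cancels, so \<open>m\<close> can be fixed before it.\<close>
  obtain m :: nat where m0: "real m > real (card F) * C\<^sup>2 / \<eta>\<^sup>2"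
    using reals_Archimedean2 by blast
  have "m > 0"
  proof -
    have "0 \<le> real (card F) * C\<^sup>2 / \<eta>\<^sup>2" by simp
    with m0 show ?thesis by linarith
  qed
  have m: "real (card F) * C\<^sup>2 \<le> real m * \<eta>\<^sup>2"
    using m0 \<open>\<eta> > 0\<close> by (simp add: field_simps)
  \<comment> \<open>The first summand meets the threshold of the specification property, the second
    leaves room for a nonempty segment and a gap in every block, and the third makes the cost of
    gaps and rounding at most \<open>\<eta> * n\<close>.\<close>
  obtain N' :: nat where N': "real N' > real N + (1 + \<epsilon>) * real m * (real M + 3)
      + 2 * C * real m * (real M + 2) / \<eta>"
    using reals_Archimedean2 by blast
  obtain n where "n \<in> P" "n > N'"
    using P(2) by (meson infinite_nat_iff_unbounded)
  have nonneg: "0 \<le> (1 + \<epsilon>) * real m * (real M + 3)" "0 \<le> 2 * C * real m * (real M + 2) / \<eta>"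
    using \<open>\<epsilon> > 0\<close> \<open>C > 0\<close> \<open>\<eta> > 0\<close> by auto
  have nN: "real n \<ge> real N" and nM: "real n \<ge> (1 + \<epsilon>) * real m * (real M + 3)"
    and nC: "real n \<ge> 2 * C * real m * (real M + 2) / \<eta>" and "n > 0"
    using N' \<open>n > N'\<close> nonneg by linarith+
  \<comment> \<open>Ideal block length: \<open>m\<close> blocks fill
    \<open>n / (1 + \<epsilon>)\<close>, the most that the condition on the period allows in
    general.\<close>
  define q where "q = real n / ((1 + \<epsilon>) * real m)"
  define K where "K = nat \<lfloor>q\<rfloor>"
  \<comment> \<open>The gap is \<open>M + 1\<close> and not \<open>M\<close>, since consecutive
    segments must be strictly separated even when \<open>M = 0\<close>.\<close>
  define L where "L = K - (M + 1)"
  have pos: "(1 + \<epsilon>) * real m > 0" using \<open>\<epsilon> > 0\<close> \<open>m > 0\<close> by simp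
  have q: "q \<ge> real M + 3"
    using nM pos by (simp add: q_def pos_le_divide_eq mult.commute)
  have Kq: "real K \<le> q" "q < real K + 1"
    using q unfolding K_def by linarith+
  then have "K \<ge> M + 2" using q by linarith
  then have L: "L > 0" "K = L + M + 1" by (auto simp: L_def)
  have qn: "(1 + \<epsilon>) * (real m * q) = real n"
    using \<open>\<epsilon> > 0\<close> \<open>m > 0\<close> by (simp add: q_def)
  have mKn: "(1 + \<epsilon>) * (real m * real K) \<le> real n"
    unfolding qn[symmetric] using Kq \<open>\<epsilon> > 0\<close> by (intro mult_left_mono) auto
  have "real m * real K \<le> (1 + \<epsilon>) * (real m * real K)"
    using \<open>\<epsilon> > 0\<close> by (simp add: algebra_simps)
  with mKn have "real (m * K) \<le> real n" by simp
  then have mK: "m * K \<le> n" by linarith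
  \<comment> \<open>Since \<open>1 / (1 + \<epsilon>) \<ge> 1 - \<epsilon>\<close>, the blocks of
    ideal length miss at most \<open>\<epsilon> * n\<close> times. Each block then loses at most
    \<open>M + 2\<close> more: \<open>M + 1\<close> for the gap and 1 for rounding \<open>q\<close>
    down.\<close>
  have waste: "2 * C * (real n - real m * real L) \<le> 2 * C * \<epsilon> * real n + \<eta> * real n"
  proof -
    have "real m * q \<ge> real n * (1 - \<epsilon>)"
    proof -
      have "real m * q = real n / (1 + \<epsilon>)"
        using qn \<open>\<epsilon> > 0\<close> by (simp add: field_simps)
      moreover have "(1 - \<epsilon>) * (1 + \<epsilon>) \<le> 1" by (simp add: algebra_simps)
      then have "real n * (1 - \<epsilon>) * (1 + \<epsilon>) \<le> real n"
        using mult_left_mono[of "(1 - \<epsilon>) * (1 + \<epsilon>)" 1 "real n"] by (simp add: mult.assoc)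
      ultimately show ?thesis
        using \<open>\<epsilon> > 0\<close> by (simp add: pos_le_divide_eq)
    qed
    moreover have "real m * q \<le> real m * (real K + 1)"
      using Kq by (intro mult_left_mono) auto
    moreover have "real m * (real K + 1) = real m * real L + real m * (real M + 2)"
      by (simp add: L algebra_simps)
    ultimately have "real n - real m * real L \<le> \<epsilon> * real n + real m * (real M + 2)"
      by (simp add: algebra_simps)
    then have "2 * C * (real n - real m * real L) \<le> 2 * C * (\<epsilon> * real n + real m * (real M + 2))"
      using \<open>C > 0\<close> by (intro mult_left_mono) auto
    moreover have "2 * C * real m * (real M + 2) \<le> \<eta> * real n"
      using nC \<open>\<eta> > 0\<close> by (simp add: field_simps)
    ultimately show ?thesis by (simp add: algebra_simps)
  qed
  have mL: "real m * real L \<le> real n"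
  proof -
    have "m * L \<le> m * K" using L by (intro mult_left_mono) auto
    with mK have "m * L \<le> n" by linarith
    then show ?thesis by (metis of_nat_le_iff of_nat_mult)
  qed

  \<comment> \<open>Sampling of the Birkhoff sums\<close>
  define G where "G f x = (\<Sum>s<L. f ((T ^^ s) x))" for f :: "'a \<Rightarrow> real" and x
  \<comment> \<open>By invariance every term of the Birkhoff sum has the same mean as
    \<open>f\<close>.\<close>
  have EG: "expectation (G f) = real L * integral\<^sup>L \<mu> f" if "f \<in> F" for f
  proof -
    note [measurable] = meas[OF that]
    have "integrable \<mu> (\<lambda>x. f ((T ^^ s) x))" for s
      by (intro integrable_const_bound[where B = C] AE_I2) (auto simp: C that)
    then have "expectation (G f) = (\<Sum>s<L. integral\<^sup>L \<mu> (\<lambda>x. f ((T ^^ s) x)))"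
      unfolding G_def by (intro Bochner_Integration.integral_sum) auto
    also have "\<dots> = real L * integral\<^sup>L \<mu> f"
      by (simp add: integral_invariant[OF \<mu> T meas[OF that]])
    finally show ?thesis .
  qed
  have "\<exists>y. (\<forall>j<m. y j \<in> space \<mu>) \<and>
      (\<Sum>f\<in>F. (\<Sum>j<m. G f (y j) - expectation (G f))\<^sup>2) \<le> real m * (real (card F) * (real L * C)\<^sup>2)"
  proof (rule exists_empirical_average[OF F(1)])
    fix f assume f: "f \<in> F"
    note [measurable] = meas[OF f]
    show "G f \<in> borel_measurable \<mu>" unfolding G_def by measurable
    show "\<bar>G f x\<bar> \<le> real L * C" for x
    proof -
      have "\<bar>G f x\<bar> \<le> real (card {..<L}) * C"
        unfolding G_def by (rule order_trans[OF sum_abs sum_bounded_above]) (rule C[OF f])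
      then show ?thesis by simp
    qed
  qed
  then obtain y where y:
    "(\<Sum>f\<in>F. (\<Sum>j<m. G f (y j) - expectation (G f))\<^sup>2) \<le> real m * (real (card F) * (real L * C)\<^sup>2)"
    by blast
  \<comment> \<open>A single square is at most the sum of the squares over \<open>F\<close>, and the
    choice of \<open>m\<close> absorbs the factor \<open>card F\<close>.\<close>
  have emp: "\<bar>\<Sum>j<m. G f (y j) - real L * integral\<^sup>L \<mu> f\<bar> \<le> \<eta> * (real m * real L)" if f: "f \<in> F" for f
  proof (rule power2_le_imp_le)
    have "\<bar>\<Sum>j<m. G f (y j) - real L * integral\<^sup>L \<mu> f\<bar>\<^sup>2 = (\<Sum>j<m. G f (y j) - expectation (G f))\<^sup>2"
      by (simp add: EG[OF f])
    also have "\<dots> \<le> (\<Sum>f\<in>F. (\<Sum>j<m. G f (y j) - expectation (G f))\<^sup>2)"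
      by (rule member_le_sum[OF f]) (auto simp: F)
    also note y
    also have "real m * (real (card F) * (real L * C)\<^sup>2) = real m * (real L)\<^sup>2 * (real (card F) * C\<^sup>2)"
      by (simp add: power_mult_distrib)
    also have "\<dots> \<le> real m * (real L)\<^sup>2 * (real m * \<eta>\<^sup>2)"
      using m by (intro mult_left_mono) auto
    also have "\<dots> = (\<eta> * (real m * real L))\<^sup>2"
      by (simp add: power2_eq_square)
    finally show "\<bar>\<Sum>j<m. G f (y j) - real L * integral\<^sup>L \<mu> f\<bar>\<^sup>2 \<le> (\<eta> * (real m * real L))\<^sup>2" .
    show "0 \<le> \<eta> * (real m * real L)" using \<open>\<eta> > 0\<close> by simp
  qed

  \<comment> \<open>The specification and its periodic tracing point\<close>
  have surj: "\<exists>x. (T ^^ s) x = w" for s w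
  proof -
    have "surj (T ^^ s)" using \<open>surj T\<close> by (rule surj_fn)
    then show ?thesis by (metis surjD)
  qed
  define a b where "a i = (i - 1) * K" and "b i = (i - 1) * K + L" for i
  \<comment> \<open>In a specification the segment over the times from \<open>a i\<close> on starts
    at the \<open>a i\<close>-th iterate of \<open>x i\<close>, so \<open>x i\<close> is a preimage
    of the sample under that iterate. Segments are numbered from 1 and samples from 0, hence
    \<open>i - 1\<close>.\<close>
  define x where "x i = (SOME x. (T ^^ a i) x = y (i - 1))" for i
  have x: "(T ^^ a i) (x i) = y (i - 1)" for i
    unfolding x_def by (rule someI_ex[OF surj])
  have spaced: "spaced_specification M m a b"
    unfolding spaced_specification_def
  proof (intro conjI ballI)
    fix i assume "i \<in> {2..m}"
    then have "i = Suc (Suc (i - 2))" by auto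
    then obtain j where "i = Suc (Suc j)" by blast
    then show "b (i - 1) < a i" "M \<le> a i - b (i - 1)"
      by (simp_all add: a_def b_def L)
  qed (use \<open>m > 0\<close> L in \<open>auto simp: a_def b_def\<close>)
  \<comment> \<open>The last segment ends within the \<open>m\<close> blocks, whose length already
    includes the margin \<open>1 + \<epsilon>\<close> relative to \<open>n\<close>.\<close>
  have "b m \<le> m * K"
  proof -
    obtain j where "m = Suc j" using \<open>m > 0\<close> gr0_implies_Suc by blast
    then show ?thesis by (simp add: b_def L)
  qed
  then have "real (b m) \<le> real m * real K"
    by (metis of_nat_le_iff of_nat_mult)
  then have "(1 + \<epsilon>) * real (b m) \<le> (1 + \<epsilon>) * (real m * real K)"
    using \<open>\<epsilon> > 0\<close> by (intro mult_left_mono) auto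
  then have "real n \<ge> max (real N) ((1 + \<epsilon>) * real (b m))"
    using mKn nN by simp
  from spec[OF spaced \<open>n \<in> P\<close> this, of x] obtain z where per: "(T ^^ n) z = z"
    and trace: "partially_traces T \<epsilon> m a b x z"
    by blast

  \<comment> \<open>Comparison of the periodic average with the integral\<close>
  have "\<bar>(\<Sum>t<n. f ((T ^^ t) z)) / real n - integral\<^sup>L \<mu> f\<bar> < \<delta>" if f: "f \<in> F" for f
  proof -
    define c where "c = integral\<^sup>L \<mu> f"
    define h where "h t = f ((T ^^ t) z) - c" for t
    have "\<bar>c\<bar> \<le> C"
    proof -
      have i: "integrable \<mu> f"
        using meas[OF f] by (intro integrable_const_bound[where B = C] AE_I2)
          (auto simp: C[OF f] measurable_cong_sets[OF sets refl])
      have "f x \<le> C" "- C \<le> f x" for x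
        using C[OF f, of x] by linarith+
      then have "c \<le> C" "- C \<le> c"
        unfolding c_def using i by (auto intro: integral_le_const integral_ge_const)
      then show ?thesis by linarith
    qed
    then have h: "\<bar>h t\<bar> \<le> 2 * C" for t
      using C[OF f, of "(T ^^ t) z"] unfolding h_def by linarith
    define e where "e i = (\<Sum>t=i*K..<i*K+L. f ((T ^^ t) z) - f ((T ^^ t) (x (Suc i))))" for i
    have e: "\<bar>e i\<bar> \<le> real L * (2 * C * \<epsilon> + \<eta>)" if "i < m" for i
    proof -
      have "real (card {n. i*K \<le> n \<and> n < i*K+L \<and> dist ((T ^^ n) z) ((T ^^ n) (x (Suc i))) < \<epsilon>})
          / real (i*K+L - i*K) > 1 - \<epsilon>"
        using bspec[OF trace[unfolded partially_traces_def], of "Suc i"] that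
        by (simp add: a_def b_def)
      moreover have "\<bar>f u - f w\<bar> \<le> \<eta>" if "dist u w < \<epsilon>" for u w
        using d[OF f, of u w] that by (simp add: \<epsilon>_def)
      ultimately have "\<bar>e i\<bar> \<le> real (i*K+L - i*K) * (2 * C * \<epsilon> + \<eta>)"
        unfolding e_def using L \<open>\<eta> > 0\<close> by (intro partial_tracing_sum C[OF f]) auto
      then show ?thesis by simp
    qed
    \<comment> \<open>Splits the deviation on one segment into the tracing error \<open>e i\<close>
      and the sampling error of \<open>y i\<close>.\<close>
    have seg: "(\<Sum>t=i*K..<i*K+L. h t) = e i + (G f (y i) - real L * c)" for i
    proof -
      have "G f (y i) = (\<Sum>s<L. f ((T ^^ (s + i * K)) (x (Suc i))))"
        using x[of "Suc i"] by (simp add: G_def funpow_add a_def)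
      also have "\<dots> = (\<Sum>t=i*K..<i*K+L. f ((T ^^ t) (x (Suc i))))"
        using sum.shift_bounds_nat_ivl[of "\<lambda>t. f ((T ^^ t) (x (Suc i)))" 0 "i*K" L]
        by (simp add: atLeast0LessThan add.commute)
      finally show ?thesis
        by (simp add: e_def h_def sum_subtractf)
    qed
    have "\<bar>\<Sum>i<m. e i\<bar> \<le> real (card {..<m}) * (real L * (2 * C * \<epsilon> + \<eta>))"
      by (rule order_trans[OF sum_abs sum_bounded_above]) (simp add: e)
    also have "\<dots> = real m * real L * (2 * C * \<epsilon> + \<eta>)" by simp
    also have "\<dots> \<le> real n * (2 * C * \<epsilon> + \<eta>)"
      using mL \<open>C > 0\<close> \<open>\<epsilon> > 0\<close> \<open>\<eta> > 0\<close> by (intro mult_right_mono) auto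
    finally have 1: "\<bar>\<Sum>i<m. e i\<bar> \<le> real n * (2 * C * \<epsilon> + \<eta>)" .
    have "\<eta> * (real m * real L) \<le> \<eta> * real n"
      using mL \<open>\<eta> > 0\<close> by (intro mult_left_mono) auto
    with emp[OF f] have 2: "\<bar>\<Sum>j<m. G f (y j) - real L * c\<bar> \<le> \<eta> * real n"
      unfolding c_def by linarith
    have 3: "\<bar>\<Sum>t<n. h t\<bar> \<le> \<bar>\<Sum>i<m. \<Sum>t=i*K..<i*K+L. h t\<bar> + 2 * C * (real n - real m * real L)"
      using L by (intro sum_blocks_bound h mK) simp
    have 4: "(\<Sum>i<m. \<Sum>t=i*K..<i*K+L. h t) = (\<Sum>i<m. e i) + (\<Sum>i<m. G f (y i) - real L * c)"
      by (simp add: seg sum.distrib)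
    have "4 * C * \<epsilon> * real n \<le> \<eta> * real n"
      using \<epsilon>C by (intro mult_right_mono) auto
    \<comment> \<open>The three groups are the tracing error, the sampling error and the discarded
      times. Together they are \<open>(4 * C * \<epsilon> + 3 * \<eta>) * n\<close>, hence at most
      \<open>4 * \<eta> * n\<close>.\<close>
    moreover have "\<bar>\<Sum>t<n. h t\<bar> \<le> real n * (2 * C * \<epsilon> + \<eta>) + \<eta> * real n
        + (2 * C * \<epsilon> * real n + \<eta> * real n)"
      using 1 2 3 4 waste by linarith
    ultimately have "\<bar>\<Sum>t<n. h t\<bar> \<le> 4 * \<eta> * real n"
      by (simp add: algebra_simps)
    also have "\<dots> < \<delta> * real n"
      using \<open>\<delta> > 0\<close> \<open>n > 0\<close> by (simp add: \<eta>_def)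
    finally have "\<bar>\<Sum>t<n. h t\<bar> / real n < \<delta>"
      using \<open>n > 0\<close> by (simp add: pos_divide_less_eq)
    moreover have "(\<Sum>t<n. f ((T ^^ t) z)) / real n - c = (\<Sum>t<n. h t) / real n"
      using \<open>n > 0\<close> by (simp add: h_def sum_subtractf field_simps)
    ultimately show ?thesis
      by (simp add: c_def)
  qed
  with per \<open>n > 0\<close> show ?thesis by blast
qed

section \<open>Density in the weak* topology\<close>

lemma topspace_weak_star_topology: "topspace weak_star_topology = borel_prob_measures"
  by (auto simp: weak_star_topology_def topspace_pullback_topology)

text \<open>A basic open set of the product topology restricts only finitely many coordinates. The
  finitely many functions with a proper restriction form \<open>F\<close>, and the smallest of their
  radii serves as \<open>\<delta>\<close>.\<close>

lemma weak_star_neighbourhood: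
  fixes U :: "'a::topological_space measure set"
  assumes "openin weak_star_topology U" "\<mu> \<in> U"
  obtains F :: "('a \<Rightarrow> real) set" and \<delta> where "finite F" "\<forall>f\<in>F. continuous_on UNIV f" "\<delta> > 0"
    "\<forall>\<nu>\<in>borel_prob_measures. (\<forall>f\<in>F. \<bar>integral\<^sup>L \<nu> f - integral\<^sup>L \<mu> f\<bar> < \<delta>) \<longrightarrow> \<nu> \<in> U"
proof -
  let ?CC = "{f :: 'a \<Rightarrow> real. continuous_on UNIV f}"
  let ?\<Phi> = "\<lambda>\<mu>. \<lambda>f\<in>?CC. integral\<^sup>L \<mu> f"
  obtain W where W: "openin (powertop_real ?CC) W" and U: "U = ?\<Phi> -` W \<inter> borel_prob_measures"
    using assms(1) unfolding weak_star_topology_def openin_pullback_topology by blast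
  have "?\<Phi> \<mu> \<in> W" using assms(2) U by auto
  from bspec[OF W[unfolded openin_product_topology_alt] this]
  obtain V where fin: "finite {f \<in> ?CC. V f \<noteq> UNIV}" and op: "\<And>f. f \<in> ?CC \<Longrightarrow> open (V f)"
    and in_V: "?\<Phi> \<mu> \<in> Pi\<^sub>E ?CC V" and sub: "Pi\<^sub>E ?CC V \<subseteq> W"
    unfolding open_openin[symmetric] topspace_euclidean by blast
  define F where "F = {f \<in> ?CC. V f \<noteq> UNIV}"
  have "\<exists>e>0. \<forall>v. \<bar>v - integral\<^sup>L \<mu> f\<bar> < e \<longrightarrow> v \<in> V f" if "f \<in> F" for f
  proof -
    have "f \<in> ?CC" using that by (simp add: F_def)
    then have "integral\<^sup>L \<mu> f \<in> V f" using in_V by (auto simp: PiE_iff)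
    with op[OF \<open>f \<in> ?CC\<close>] show ?thesis
      by (auto simp: open_dist dist_real_def)
  qed
  then obtain e where e: "\<And>f. f \<in> F \<Longrightarrow> e f > 0"
    "\<And>f v. f \<in> F \<Longrightarrow> \<bar>v - integral\<^sup>L \<mu> f\<bar> < e f \<Longrightarrow> v \<in> V f"
    by metis
  \<comment> \<open>The inserted 1 keeps the minimum meaningful when no coordinate is
    restricted.\<close>
  define \<delta> where "\<delta> = Min (insert 1 (e ` F))"
  have finF: "finite F" using fin by (simp add: F_def)
  have "\<delta> > 0" using finF e(1) by (auto simp: \<delta>_def)
  moreover have "\<nu> \<in> U" if \<nu>: "\<nu> \<in> borel_prob_measures"
    and close: "\<And>f. f \<in> F \<Longrightarrow> \<bar>integral\<^sup>L \<nu> f - integral\<^sup>L \<mu> f\<bar> < \<delta>" for \<nu>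
  proof -
    have "integral\<^sup>L \<nu> f \<in> V f" if "f \<in> ?CC" for f
    proof (cases "f \<in> F")
      case True
      then have "\<delta> \<le> e f" using finF by (auto simp: \<delta>_def)
      with close[OF True] show ?thesis by (intro e(2)[OF True]) linarith
    next
      case False
      with that show ?thesis by (simp add: F_def)
    qed
    then have "?\<Phi> \<nu> \<in> W"
      by (intro subsetD[OF sub]) (simp add: restrict_PiE_iff)
    with \<nu> show ?thesis by (simp add: U)
  qed
  moreover have "continuous_on UNIV f" if "f \<in> F" for f
    using that by (simp add: F_def)
  ultimately show ?thesis
    using that[of F \<delta>] finF by simp
qed

theorem corollary3p12:
  fixes T :: "'a::metric_space \<Rightarrow> 'a"
  assumes "compact (UNIV :: 'a set)"
    and "diameter (UNIV :: 'a set) = 1"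
    and "continuous_on UNIV T"
    and "surj T"
    and "partial_specification_property T"
  shows "subtopology weak_star_topology (invariant_measures T) closure_of (ergodic_measures T)
           = invariant_measures T"
proof (rule subset_antisym)
  have inv: "invariant_measures T \<subseteq> borel_prob_measures"
    by (auto simp: invariant_measures_def)
  have erg: "ergodic_measures T \<subseteq> invariant_measures T"
    by (auto simp: ergodic_measures_def)
  have top: "topspace (subtopology weak_star_topology (invariant_measures T)) = invariant_measures T"
    using inv by (auto simp: topspace_weak_star_topology)
  show "subtopology weak_star_topology (invariant_measures T) closure_of (ergodic_measures T)
      \<subseteq> invariant_measures T"
    using closure_of_subset_topspace[of "subtopology weak_star_topology (invariant_measures T)"] top
    by metis
  obtain P where P: "infinite P" "partial_specification_with_periods T P"
    using assms(5) unfolding partial_specification_property_def by blast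
  show "invariant_measures T
      \<subseteq> subtopology weak_star_topology (invariant_measures T) closure_of (ergodic_measures T)"
  proof
    fix \<mu> assume \<mu>: "\<mu> \<in> invariant_measures T"
    have "\<exists>\<nu>\<in>ergodic_measures T. \<nu> \<in> U"
      if U: "openin weak_star_topology U" "\<mu> \<in> U" for U
    proof -
      obtain F :: "('a \<Rightarrow> real) set" and \<delta> where F: "finite F" "\<forall>f\<in>F. continuous_on UNIV f" and "\<delta> > 0"
        and nb: "\<forall>\<nu>\<in>borel_prob_measures.
          (\<forall>f\<in>F. \<bar>integral\<^sup>L \<nu> f - integral\<^sup>L \<mu> f\<bar> < \<delta>) \<longrightarrow> \<nu> \<in> U"
        by (rule weak_star_neighbourhood[OF U])
      obtain n z where n: "n > 0" "(T ^^ n) z = z"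
        and close: "\<forall>f\<in>F. \<bar>(\<Sum>t<n. f ((T ^^ t) z)) / real n - integral\<^sup>L \<mu> f\<bar> < \<delta>"
        using exists_periodic_averages[OF assms(1,3,4) P(2,1) \<mu> F(1) F(2)[rule_format] \<open>\<delta> > 0\<close>]
        by blast
      have "integral\<^sup>L (orbit_measure T n z) f = (\<Sum>t<n. f ((T ^^ t) z)) / real n" if "f \<in> F" for f
        using n(1) F(2) that by (intro integral_orbit_measure borel_measurable_continuous_onI) auto
      with close have "orbit_measure T n z \<in> U"
        by (intro nb[rule_format] orbit_measure_in_borel_prob_measures) simp
      with orbit_measure_ergodic[OF assms(3) n] show ?thesis by blast
    qed
    \<comment> \<open>Open sets of the subspace are traces of weak* open sets on the invariant
      measures, and the ergodic measure found in \<open>U\<close> lies in such a trace because it is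
      invariant.\<close>
    then show "\<mu> \<in> subtopology weak_star_topology (invariant_measures T) closure_of (ergodic_measures T)"
      unfolding in_closure_of top using \<mu> erg by (auto simp: openin_subtopology)
  qed
qed

end
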